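(* Let $\underline{\delta}(x)=\inf_{\pi\in\Gamma}\delta_\pi(x)$ and $\overline{\delta}(x)=\sup_{\pi\in\Gamma}\delta_\pi(x)$, where $\delta_\pi$ is the Bayes estimator of $\theta$ under the prior $\pi$, and suppose that $\underline{\delta}(x)$ and $\overline{\delta}(x)$ are finite almost everywhere. Then the posterior regret gamma-minimax (PRGM) estimator of $\theta$ in the exponential family $f(x|\theta)=\beta(\theta)t(x)e^{-\theta r(x)}$, under the loss function $$L(\theta,\delta)=\log\frac{\beta(\theta)}{\beta(\delta)}+(\delta-\theta)\frac{\beta'(\theta)}{\beta(\theta)}$$ and in the class of prior distributions $\Gamma$, is given by $$\delta_{PR}(X)=\frac{\overline{\delta}(X)\,H(\overline{\delta}(X))-\underline{\delta}(X)\,H(\underline{\delta}(X))-\log\dfrac{\beta(\overline{\delta}(X))}{\beta(\underline{\delta}(X))}}{H(\overline{\delta}(X))-H(\underline{\delta}(X))},\qquad H=\beta'/\beta .$$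
   Context: Setting. $X$ is a random variable whose distribution belongs to the one-parameter exponential family $\{f(x|\theta):x\in\chi\subseteq\mathbb{R},\ \theta\in\Theta\subseteq\mathbb{R}\}$ with density $f(x|\theta)=\beta(\theta)t(x)e^{-\theta r(x)}$ (with respect to Lebesgue measure for continuous and counting measure for discrete distributions), where $r(x)>0$, $\beta(\theta)t(x)>0$, and $\theta$ is the unknown real-valued natural parameter. Put $H(t)=\beta'(t)/\beta(t)$; then $E_\theta[r(X)]=H(\theta)$ and $H$ is decreasing. For $\theta,\delta\in\Theta$ the loss $L(\theta,\delta)$ above is the Kullback–Leibler divergence $E_\theta[\log(f(X|\theta)/f(X|\delta))]$ (the intrinsic loss). Bayes and PRGM estimation. $\Gamma$ is a class of prior distributions on $\Theta$. For a prior $\pi$ with posterior distribution $\pi(\cdot|x)$, the posterior risk of an estimate $\delta(x)$ is $r(x,\delta)=E[L(\theta,\delta(x))|x]$. The Bayes estimator $\delta_\pi$ minimizes the posterior risk, and is $\delta_\pi(X)=H^{-1}\{E(H(\theta)|X)\}$. The posterior regret is $\rho(\delta_\pi,\delta)=r(x,\delta)-r(x,\delta_\pi)$. The PRGM estimator under $L$ and $\Gamma$ is an estimator $\delta_{PR}$ such that $\sup_{\pi\in\Gamma}\rho(\delta_\pi(x),\delta_{PR}(x))=\inf_{\delta}\sup_{\pi\in\Gamma}\rho(\delta_\pi(x),\delta(x))$. *)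

theory Defs
  imports "HOL-Probability.Probability"
begin

(* "Continuous" and "discrete" distributions on the sample space S. In the discrete case no
   countability is required: a strictly positive density with total mass 1 forces it. *)
definition reference_measure :: "real set \<Rightarrow> real measure \<Rightarrow> bool" where
  "reference_measure S \<mu> \<longleftrightarrow>
     (S \<in> sets borel \<and> \<mu> = restrict_space lborel S) \<or> \<mu> = count_space S"

definition family_density ::
  "(real \<Rightarrow> real) \<Rightarrow> (real \<Rightarrow> real) \<Rightarrow> (real \<Rightarrow> real) \<Rightarrow> real \<Rightarrow> real \<Rightarrow> real" where
  "family_density \<beta> t r x \<theta> = \<beta> \<theta> * t x * exp (- \<theta> * r x)"

definition exponential_family ::
  "real set \<Rightarrow> real measure \<Rightarrow> real set \<Rightarrow> (real \<Rightarrow> real) \<Rightarrow> (real \<Rightarrow> real) \<Rightarrow> (real \<Rightarrow> real) \<Rightarrow> bool"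
where
  "exponential_family S \<mu> \<Theta> \<beta> t r \<longleftrightarrow>
     reference_measure S \<mu> \<and>
     is_interval \<Theta> \<and>
     \<beta> differentiable_on \<Theta> \<and>
     t \<in> borel_measurable \<mu> \<and> r \<in> borel_measurable \<mu> \<and>
     (\<forall>x\<in>S. r x > 0) \<and>
     (\<forall>x\<in>S. \<forall>\<theta>\<in>\<Theta>. \<beta> \<theta> * t x > 0) \<and>
     (\<forall>\<theta>\<in>\<Theta>. (\<integral>\<^sup>+ x. ennreal (family_density \<beta> t r x \<theta>) \<partial>\<mu>) = 1)"

(* The derivative is taken within Theta, hence one-sided at an endpoint belonging to Theta.
   Normalisation of the densities makes log |beta| concave, so H is decreasing on Theta, and
   strictly so as soon as it is injective, that is, as soon as its inverse makes sense. *)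
definition H_fun :: "real set \<Rightarrow> (real \<Rightarrow> real) \<Rightarrow> real \<Rightarrow> real" where
  "H_fun \<Theta> \<beta> \<theta> = vector_derivative \<beta> (at \<theta> within \<Theta>) / \<beta> \<theta>"

definition intrinsic_loss :: "real set \<Rightarrow> (real \<Rightarrow> real) \<Rightarrow> real \<Rightarrow> real \<Rightarrow> real" where
  "intrinsic_loss \<Theta> \<beta> \<theta> \<delta> = ln (\<beta> \<theta> / \<beta> \<delta>) + (\<delta> - \<theta>) * H_fun \<Theta> \<beta> \<theta>"

(* The underlying measurable space of a prior is Theta itself. *)
definition prior_on :: "real set \<Rightarrow> real measure \<Rightarrow> bool" where
  "prior_on \<Theta> \<pi> \<longleftrightarrow> prob_space \<pi> \<and> sets \<pi> = sets (restrict_space borel \<Theta>)"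

definition marginal ::
  "(real \<Rightarrow> real) \<Rightarrow> (real \<Rightarrow> real) \<Rightarrow> (real \<Rightarrow> real) \<Rightarrow> real measure \<Rightarrow> real \<Rightarrow> ennreal" where
  "marginal \<beta> t r \<pi> x = (\<integral>\<^sup>+ \<theta>. ennreal (family_density \<beta> t r x \<theta>) \<partial>\<pi>)"

(* A probability measure whenever the marginal density is finite at x. *)
definition posterior ::
  "(real \<Rightarrow> real) \<Rightarrow> (real \<Rightarrow> real) \<Rightarrow> (real \<Rightarrow> real) \<Rightarrow> real measure \<Rightarrow> real \<Rightarrow> real measure" where
  "posterior \<beta> t r \<pi> x =
     density \<pi> (\<lambda>\<theta>. ennreal (family_density \<beta> t r x \<theta>) / marginal \<beta> t r \<pi> x)"

definition posterior_risk ::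
  "real set \<Rightarrow> (real \<Rightarrow> real) \<Rightarrow> (real \<Rightarrow> real) \<Rightarrow> (real \<Rightarrow> real) \<Rightarrow> real measure \<Rightarrow> real \<Rightarrow> real \<Rightarrow> real"
where
  "posterior_risk \<Theta> \<beta> t r \<pi> x d = (\<integral>\<theta>. intrinsic_loss \<Theta> \<beta> \<theta> d \<partial>posterior \<beta> t r \<pi> x)"

(* Regularity implicit in speaking of the posterior risk and of the regret, which is a
   difference of posterior risks. *)
definition finite_posterior_risk ::
  "real set \<Rightarrow> (real \<Rightarrow> real) \<Rightarrow> (real \<Rightarrow> real) \<Rightarrow> (real \<Rightarrow> real) \<Rightarrow> real measure \<Rightarrow> real \<Rightarrow> bool" where
  "finite_posterior_risk \<Theta> \<beta> t r \<pi> x \<longleftrightarrow>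
     marginal \<beta> t r \<pi> x < \<infinity> \<and>
     (\<forall>d\<in>\<Theta>. integrable (posterior \<beta> t r \<pi> x) (\<lambda>\<theta>. intrinsic_loss \<Theta> \<beta> \<theta> d))"

definition bayes_estimator ::
  "real set \<Rightarrow> (real \<Rightarrow> real) \<Rightarrow> (real \<Rightarrow> real) \<Rightarrow> (real \<Rightarrow> real) \<Rightarrow> real measure \<Rightarrow> real \<Rightarrow> real"
where
  "bayes_estimator \<Theta> \<beta> t r \<pi> x = arg_min_on (posterior_risk \<Theta> \<beta> t r \<pi> x) \<Theta>"

definition posterior_regret ::
  "real set \<Rightarrow> (real \<Rightarrow> real) \<Rightarrow> (real \<Rightarrow> real) \<Rightarrow> (real \<Rightarrow> real) \<Rightarrow> real measure \<Rightarrow> real \<Rightarrow> real \<Rightarrow> real"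
where
  "posterior_regret \<Theta> \<beta> t r \<pi> x d =
     posterior_risk \<Theta> \<beta> t r \<pi> x d - posterior_risk \<Theta> \<beta> t r \<pi> x (bayes_estimator \<Theta> \<beta> t r \<pi> x)"

definition lower_bayes ::
  "real set \<Rightarrow> (real \<Rightarrow> real) \<Rightarrow> (real \<Rightarrow> real) \<Rightarrow> (real \<Rightarrow> real) \<Rightarrow> real measure set \<Rightarrow> real \<Rightarrow> ereal"
where
  "lower_bayes \<Theta> \<beta> t r \<Gamma> x = (INF \<pi>\<in>\<Gamma>. ereal (bayes_estimator \<Theta> \<beta> t r \<pi> x))"

definition upper_bayes ::
  "real set \<Rightarrow> (real \<Rightarrow> real) \<Rightarrow> (real \<Rightarrow> real) \<Rightarrow> (real \<Rightarrow> real) \<Rightarrow> real measure set \<Rightarrow> real \<Rightarrow> ereal"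
where
  "upper_bayes \<Theta> \<beta> t r \<Gamma> x = (SUP \<pi>\<in>\<Gamma>. ereal (bayes_estimator \<Theta> \<beta> t r \<pi> x))"

definition max_regret ::
  "real set \<Rightarrow> (real \<Rightarrow> real) \<Rightarrow> (real \<Rightarrow> real) \<Rightarrow> (real \<Rightarrow> real) \<Rightarrow> real measure set \<Rightarrow> real \<Rightarrow> real
    \<Rightarrow> ereal"
where
  "max_regret \<Theta> \<beta> t r \<Gamma> x d = (SUP \<pi>\<in>\<Gamma>. ereal (posterior_regret \<Theta> \<beta> t r \<pi> x d))"

(* The criterion is pointwise in x, so the competing estimators are arbitrary functions from S
   to Theta; measurable ones give the same infimum, since they include all constants. *)
definition PRGM_estimator ::
  "real set \<Rightarrow> real measure \<Rightarrow> real set \<Rightarrow> (real \<Rightarrow> real) \<Rightarrow> (real \<Rightarrow> real) \<Rightarrow> (real \<Rightarrow> real) \<Rightarrow>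
   real measure set \<Rightarrow> (real \<Rightarrow> real) \<Rightarrow> bool"
where
  "PRGM_estimator S \<mu> \<Theta> \<beta> t r \<Gamma> \<delta> \<longleftrightarrow>
     (AE x in \<mu>. \<delta> x \<in> \<Theta> \<and>
        max_regret \<Theta> \<beta> t r \<Gamma> x (\<delta> x) = (INF \<delta>'\<in>S \<rightarrow> \<Theta>. max_regret \<Theta> \<beta> t r \<Gamma> x (\<delta>' x)))"

(* With equal bounds a = b the quotient is 0/0 and is read as its limiting value a
   (the quotient always lies between a and b). *)
definition PRGM_value :: "real set \<Rightarrow> (real \<Rightarrow> real) \<Rightarrow> real \<Rightarrow> real \<Rightarrow> real" where
  "PRGM_value \<Theta> \<beta> a b =
     (if a = b then a
      else (b * H_fun \<Theta> \<beta> b - a * H_fun \<Theta> \<beta> a - ln (\<beta> b / \<beta> a)) / (H_fun \<Theta> \<beta> b - H_fun \<Theta> \<beta> a))"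

end

theory Submission
  imports Defs
begin

(* For fixed x everything reduces to the divergence D a d = g a - g d + (d - a) H a of the
   concave potential g = ln |beta|, whose derivative is H. Under any posterior the mean of H is a
   value H c, and the regret of d equals D c d, where c is the Bayes estimate. Since D _ d
   decreases up to d and increases afterwards, and H is continuous, the maximal regret of d is
   max (D lo d) (D hi d). The first function of d increases to the right of lo, the second
   decreases to the left of hi, so the unique minimax point is where they agree. *)

section \<open>Divergence of a concave potential\<close>

text \<open>A monotone function can only be discontinuous by jumping, and a jump leaves a gap in the
  image. It is applied to \<open>- H\<close>, since continuity of \<open>H\<close> is not among the
  hypotheses.\<close>

lemma continuous_on_mono_interval_image:
  fixes f :: "real \<Rightarrow> real"
  assumes mono: "mono_on I f" and img: "is_interval (f ` I)"
  shows "continuous_on I f"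
proof -
  have "(f \<longlongrightarrow> f a) (at a within I)" if a: "a \<in> I" for a
  proof (rule order_tendstoI)
    fix l assume l: "l < f a"
    show "\<forall>\<^sub>F x in at a within I. l < f x"
    proof (cases "\<exists>y\<in>I. y < a")
      case True
      then obtain y where y: "y \<in> I" "y < a" by blast
      have "\<exists>z\<in>I. z < a \<and> l < f z"
      proof (cases "l < f y")
        case False
        \<comment> \<open>The midpoint lies between the values \<open>f y\<close> and
          \<open>f a\<close>, so it is itself a value; monotonicity puts its preimage to the left of
          \<open>a\<close>.\<close>
        then have "(l + f a) / 2 \<in> f ` I"
          using l by (intro mem_is_interval_1_I[OF img imageI[OF y(1)] imageI[OF a]]) auto
        then obtain z where z: "z \<in> I" "f z = (l + f a) / 2" by auto
        moreover have "z < a"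
          using mono_onD[OF mono a z(1)] z(2) l by (cases "z < a") auto
        ultimately show ?thesis using l by (intro bexI[of _ z]) auto
      qed (use y in blast)
      then obtain z where z: "z \<in> I" "z < a" "l < f z" by blast
      have "\<forall>\<^sub>F x in at a within I. z < x"
        using z(2) by (rule order_tendstoD(1)[OF tendsto_ident_at])
      moreover have "\<forall>\<^sub>F x in at a within I. x \<in> I"
        by (simp add: eventually_at_filter)
      ultimately show ?thesis
      proof eventually_elim
        case (elim x)
        then have "f z \<le> f x" by (intro mono_onD[OF mono z(1)]) auto
        then show ?case using z by simp
      qed
    next
      \<comment> \<open>Here \<open>a\<close> is the least element of \<open>I\<close>, so
        monotonicity alone gives the bound.\<close>
      case False
      have "\<forall>\<^sub>F x in at a within I. x \<in> I"
        by (simp add: eventually_at_filter)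
      then show ?thesis
      proof eventually_elim
        case (elim x)
        then have "f a \<le> f x" using False by (intro mono_onD[OF mono a]) (auto simp: not_less)
        then show ?case using l by simp
      qed
    qed
  next
    fix u assume u: "f a < u"
    show "\<forall>\<^sub>F x in at a within I. f x < u"
    proof (cases "\<exists>y\<in>I. a < y")
      case True
      then obtain y where y: "y \<in> I" "a < y" by blast
      have "\<exists>z\<in>I. a < z \<and> f z < u"
      proof (cases "f y < u")
        case False
        then have "(u + f a) / 2 \<in> f ` I"
          using u by (intro mem_is_interval_1_I[OF img imageI[OF a] imageI[OF y(1)]]) auto
        then obtain z where z: "z \<in> I" "f z = (u + f a) / 2" by auto
        moreover have "a < z"
          using mono_onD[OF mono z(1) a] z(2) u by (cases "a < z") auto
        ultimately show ?thesis using u by (intro bexI[of _ z]) auto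
      qed (use y in blast)
      then obtain z where z: "z \<in> I" "a < z" "f z < u" by blast
      have "\<forall>\<^sub>F x in at a within I. x < z"
        using z(2) by (rule order_tendstoD(2)[OF tendsto_ident_at])
      moreover have "\<forall>\<^sub>F x in at a within I. x \<in> I"
        by (simp add: eventually_at_filter)
      ultimately show ?thesis
      proof eventually_elim
        case (elim x)
        then have "f x \<le> f z" by (intro mono_onD[OF mono _ z(1)]) auto
        then show ?case using z by simp
      qed
    next
      case False
      have "\<forall>\<^sub>F x in at a within I. x \<in> I"
        by (simp add: eventually_at_filter)
      then show ?thesis
      proof eventually_elim
        case (elim x)
        then have "f x \<le> f a" using False by (intro mono_onD[OF mono _ a]) (auto simp: not_less)
        then show ?case using u by simp
      qed
    qed
  qed
  then show ?thesis by (simp add: continuous_on_def)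
qed

text \<open>Along the segment from \<open>x\<close> to \<open>y\<close>, the gap between
  \<open>g\<close> and its chord vanishes at 0 and is nonnegative by concavity, so its right
  derivative at 0 cannot be negative. The derivative is taken within \<open>A\<close> so that
  endpoints are covered.\<close>

lemma concave_below_tangent_within:
  fixes g :: "real \<Rightarrow> real"
  assumes deriv: "(g has_real_derivative D) (at x within A)"
    and "convex A" and x: "x \<in> A" and y: "y \<in> A"
    and concave: "\<And>s. 0 < s \<Longrightarrow> s < 1 \<Longrightarrow> (1 - s) * g x + s * g y \<le> g ((1 - s) * x + s * y)"
  shows "g y \<le> g x + D * (y - x)"
proof (rule ccontr)
  assume neg: "\<not> ?thesis"
  let ?c = "\<lambda>s. (1 - s) * x + s * y"
  let ?h = "\<lambda>s. g (?c s) - ((1 - s) * g x + s * g y)"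
  have c: "?c ` {0..1} \<subseteq> A"
    using \<open>convex A\<close> x y by (auto simp: convex_alt)
  have "(g has_real_derivative D) (at (?c 0) within ?c ` {0..1})"
    using deriv c by (auto intro: DERIV_subset)
  moreover have "(?c has_real_derivative y - x) (at 0 within {0..1})"
    by (auto intro!: derivative_eq_intros)
  ultimately have "(g \<circ> ?c has_real_derivative D * (y - x)) (at 0 within {0..1})"
    by (rule DERIV_image_chain)
  then have dh: "(?h has_real_derivative D * (y - x) - (g y - g x)) (at 0 within {0..1})"
    by (auto intro!: derivative_eq_intros simp: o_def)
  have "D * (y - x) - (g y - g x) < 0" using neg by simp
  from has_real_derivative_neg_dec_right[OF dh this]
  obtain e where e: "e > 0" "\<And>s. s > 0 \<Longrightarrow> 0 + s \<in> {0..1} \<Longrightarrow> s < e \<Longrightarrow> ?h (0 + s) < ?h 0"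
    by (elim exE conjE) (rule that, auto)
  define s where "s = min (e / 2) (1 / 2)"
  have s: "0 < s" "s < 1" "s < e" using e(1) by (auto simp: s_def)
  have "?h s < 0" using e(2)[of s] s by simp
  with concave[OF s(1,2)] show False by simp
qed

section \<open>Strict monotonicity of the derivative and positivity of the divergence\<close>

text \<open>Concavity enters as the tangent inequality, the form in which it is used below; together
  with \<open>inj\<close> it makes \<open>H\<close> strictly decreasing.\<close>

locale concave_potential =
  fixes \<Theta> :: "real set" and g H :: "real \<Rightarrow> real"
  assumes interval: "is_interval \<Theta>"
    and deriv: "\<And>x. x \<in> \<Theta> \<Longrightarrow> (g has_real_derivative H x) (at x within \<Theta>)"
    and tangent: "\<And>x y. x \<in> \<Theta> \<Longrightarrow> y \<in> \<Theta> \<Longrightarrow> g y \<le> g x + H x * (y - x)"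
    and inj: "inj_on H \<Theta>"
begin

text \<open>This is the Bregman divergence of the convex function \<open>- g\<close>. For
  \<open>g = ln |\<beta>|\<close> it is the intrinsic loss of the estimate \<open>d\<close> at the
  parameter \<open>a\<close>.\<close>

definition D :: "real \<Rightarrow> real \<Rightarrow> real" where
  "D a d = g a - g d + (d - a) * H a"

lemma D_self [simp]: "D a a = 0"
  by (simp add: D_def)

text \<open>Adding the tangent inequalities at \<open>x\<close> and at \<open>y\<close> gives the
  weak inequality; injectivity makes it strict.\<close>

lemma H_less: "H y < H x" if "x \<in> \<Theta>" "y \<in> \<Theta>" "x < y"
proof -
  have "(H x - H y) * (y - x) \<ge> 0"
    using tangent[OF that(1,2)] tangent[OF that(2,1)] by (simp add: algebra_simps)
  then have "H y \<le> H x" using that by (simp add: zero_le_mult_iff)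
  moreover have "H x \<noteq> H y" using inj_onD[OF inj, of x y] that by auto
  ultimately show ?thesis by simp
qed

lemma H_le: "H y \<le> H x" if "x \<in> \<Theta>" "y \<in> \<Theta>" "x \<le> y"
  using H_less[of x y] that by (cases "x = y") auto

text \<open>Strictness comes from the midpoint \<open>z\<close>: the tangent at \<open>x\<close>
  bounds \<open>g z\<close>, the tangent at \<open>z\<close> bounds \<open>g y\<close>, and the
  change of slope between the two is strict.\<close>

lemma D_pos: "0 < D x y" if "x \<in> \<Theta>" "y \<in> \<Theta>" "x \<noteq> y"
proof -
  define z where "z = (x + y) / 2"
  have z: "z \<in> \<Theta>"
    using mem_is_interval_1_I[OF interval that(1,2), of z]
      mem_is_interval_1_I[OF interval that(2,1), of z]
    by (cases "x \<le> y") (auto simp: z_def)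
  have zy: "y - z = z - x" by (simp add: z_def field_simps)
  have *: "(H z - H x) * (z - x) < 0"
    using H_less[OF that(1) z] H_less[OF z that(1)] that(3)
    by (cases "x < y") (auto simp: z_def mult_less_0_iff)
  have "g y \<le> g z + H z * (y - z)" "g z \<le> g x + H x * (z - x)"
    using tangent z that by auto
  then have "g y - g x \<le> H x * (y - x) + (H z - H x) * (z - x)"
    unfolding zy by (simp add: z_def field_simps)
  with * show ?thesis by (simp add: D_def algebra_simps)
qed

lemma D_nonneg: "0 \<le> D x y" if "x \<in> \<Theta>" "y \<in> \<Theta>"
  using D_pos[OF that] by (cases "x = y") auto

section \<open>Intermediate values and continuity of the derivative\<close>

text \<open>Darboux's theorem for the derivative \<open>H\<close>: maximise
  \<open>g x - m * x\<close> on \<open>{p..q}\<close>. The one-sided derivatives exclude a maximum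
  at either end, so it is interior and critical.\<close>

lemma H_attains:
  assumes p: "p \<in> \<Theta>" "m \<le> H p" and q: "q \<in> \<Theta>" "H q \<le> m"
  shows "\<exists>c\<in>\<Theta>. H c = m"
proof (cases "H p = m \<or> H q = m")
  case False
  then have m: "H q < m" "m < H p" using p q by auto
  then have pq: "p < q" using H_le[OF q(1) p(1)] by force
  let ?f = "\<lambda>x. g x - m * x"
  have sub: "{p..q} \<subseteq> \<Theta>"
    using mem_is_interval_1_I[OF interval p(1) q(1)] by auto
  have df: "(?f has_real_derivative H x - m) (at x within A)"
    if "x \<in> \<Theta>" "A \<subseteq> \<Theta>" for x A
    using DERIV_subset[OF deriv[OF that(1)] that(2)]
    by (auto intro!: derivative_eq_intros)
  have "continuous_on {p..q} ?f"
    by (rule DERIV_continuous_on, rule df) (use sub in auto)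
  then obtain c where c: "c \<in> {p..q}" and max: "\<And>x. x \<in> {p..q} \<Longrightarrow> ?f x \<le> ?f c"
    using continuous_attains_sup[of "{p..q}" ?f] pq by auto
  have "c \<noteq> p"
  proof
    assume [simp]: "c = p"
    obtain e where e: "e > 0" "\<And>h. h > 0 \<Longrightarrow> p + h \<in> {p..q} \<Longrightarrow> h < e \<Longrightarrow> ?f p < ?f (p + h)"
      using has_real_derivative_pos_inc_right[OF df[OF p(1) sub]] m by auto
    have "?f p < ?f (p + min (e / 2) (q - p))" using pq e(1) by (intro e(2)) auto
    moreover have "p + min (e / 2) (q - p) \<in> {p..q}" using pq e(1) by auto
    ultimately show False using max by fastforce
  qed
  moreover have "c \<noteq> q"
  proof
    assume [simp]: "c = q"
    obtain e where e: "e > 0" "\<And>h. h > 0 \<Longrightarrow> q - h \<in> {p..q} \<Longrightarrow> h < e \<Longrightarrow> ?f q < ?f (q - h)"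
      using has_real_derivative_neg_dec_left[OF df[OF q(1) sub]] m by auto
    have "?f q < ?f (q - min (e / 2) (q - p))" using pq e(1) by (intro e(2)) auto
    moreover have "q - min (e / 2) (q - p) \<in> {p..q}" using pq e(1) by auto
    ultimately show False using max by fastforce
  qed
  ultimately have c': "p < c" "c < q" using c by auto
  \<comment> \<open>The criterion for a local maximum requires a two-sided derivative; on the open
    interval the derivative within the set is one.\<close>
  have "(?f has_real_derivative H c - m) (at c within {p<..<q})"
    using sub c c' by (intro df) auto
  moreover have "at c within {p<..<q} = at c"
    using c' by (intro at_within_open) auto
  ultimately have "(?f has_real_derivative H c - m) (at c)" by (simp only:)
  moreover have "0 < min (c - p) (q - c)" using c' by simp
  moreover have "\<forall>y. \<bar>c - y\<bar> < min (c - p) (q - c) \<longrightarrow> ?f y \<le> ?f c"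
    by (intro allI impI max) auto
  ultimately have "H c - m = 0" by (rule DERIV_local_max)
  then show ?thesis using c sub by auto
qed (use p q in auto)

text \<open>A mean lies neither strictly above nor strictly below all values, so the intermediate
  value property applies. The resulting point will be the Bayes estimate.\<close>

lemma H_attains_mean:
  assumes "prob_space Q" and "space Q = \<Theta>" and "integrable Q H"
  shows "\<exists>c\<in>\<Theta>. H c = (\<integral>\<theta>. H \<theta> \<partial>Q)"
proof -
  interpret prob_space Q by fact
  let ?m = "\<integral>\<theta>. H \<theta> \<partial>Q"
  have "\<exists>p\<in>\<Theta>. ?m \<le> H p"
  proof (rule ccontr)
    assume "\<not> ?thesis"
    then have "AE \<theta> in Q. H \<theta> < ?m" using assms(2) by (intro AE_I2) auto
    then have "?m < ?m" by (rule expectation_less[OF assms(3)])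
    then show False by simp
  qed
  moreover have "\<exists>q\<in>\<Theta>. H q \<le> ?m"
  proof (rule ccontr)
    assume "\<not> ?thesis"
    then have "AE \<theta> in Q. H \<theta> > ?m" using assms(2) by (intro AE_I2) auto
    then have "?m < ?m" by (rule expectation_greater[OF assms(3)])
    then show False by simp
  qed
  ultimately show ?thesis using H_attains by blast
qed

text \<open>The intermediate value property makes the image of the increasing function
  \<open>- H\<close> an interval, which excludes jumps.\<close>

lemma H_continuous: "continuous_on \<Theta> H"
proof -
  have "mono_on \<Theta> (\<lambda>x. - H x)"
    by (auto intro!: mono_onI H_le)
  moreover have "is_interval ((\<lambda>x. - H x) ` \<Theta>)"
    unfolding is_interval_1
  proof safe
    fix x y z assume "x \<in> \<Theta>" "y \<in> \<Theta>" "- H x \<le> z" "z \<le> - H y"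
    then obtain c where "c \<in> \<Theta>" "H c = - z"
      using H_attains[of x "- z" y] by auto
    then show "z \<in> (\<lambda>x. - H x) ` \<Theta>" by force
  qed
  ultimately have "continuous_on \<Theta> (\<lambda>x. - H x)"
    by (rule continuous_on_mono_interval_image)
  then show ?thesis using continuous_on_minus by fastforce
qed

lemma D_continuous: "continuous_on \<Theta> (\<lambda>a. D a d)"
proof -
  have "continuous_on \<Theta> g" using deriv by (rule DERIV_continuous_on)
  then show ?thesis
    unfolding D_def by (intro continuous_intros H_continuous)
qed

section \<open>Monotonicity of the divergence in each argument, and its supremum\<close>

text \<open>This rests on the three-point identity of Bregman divergences, whose two summands are
  nonnegative here. The next three lemmas are variants of the same identity.\<close>

lemma D_decreasing_left: "D \<theta> d \<le> D a d"
  if "a \<in> \<Theta>" "\<theta> \<in> \<Theta>" "d \<in> \<Theta>" "a \<le> \<theta>" "\<theta> \<le> d"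
proof -
  have "D a d - D \<theta> d = D a \<theta> + (d - \<theta>) * (H a - H \<theta>)"
    by (simp add: D_def algebra_simps)
  moreover have "0 \<le> (d - \<theta>) * (H a - H \<theta>)"
    using H_le[OF that(1,2)] that by simp
  ultimately show ?thesis using D_nonneg[OF that(1,2)] by linarith
qed

lemma D_increasing_right: "D \<theta> d \<le> D b d"
  if "b \<in> \<Theta>" "\<theta> \<in> \<Theta>" "d \<in> \<Theta>" "\<theta> \<le> b" "d \<le> \<theta>"
proof -
  have "D b d - D \<theta> d = D b \<theta> + (\<theta> - d) * (H \<theta> - H b)"
    by (simp add: D_def algebra_simps)
  moreover have "0 \<le> (\<theta> - d) * (H \<theta> - H b)"
    using H_le[OF that(2,1)] that by simp
  ultimately show ?thesis using D_nonneg[OF that(1,2)] by linarith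
qed

text \<open>The term \<open>D d e\<close> of the three-point identity is strictly positive; this
  strictness later yields uniqueness of the minimax point.\<close>

lemma D_second_mono_right: "D a d < D a e"
  if "a \<in> \<Theta>" "d \<in> \<Theta>" "e \<in> \<Theta>" "a \<le> d" "d < e"
proof -
  have "D a e - D a d = D d e + (e - d) * (H a - H d)"
    by (simp add: D_def algebra_simps)
  moreover have "0 \<le> (e - d) * (H a - H d)"
    using H_le[OF that(1,2)] that by simp
  ultimately show ?thesis using D_pos[OF that(2,3)] that by linarith
qed

lemma D_second_mono_left: "D b d < D b e"
  if "b \<in> \<Theta>" "d \<in> \<Theta>" "e \<in> \<Theta>" "d \<le> b" "e < d"
proof -
  have "D b e - D b d = D d e + (d - e) * (H d - H b)"
    by (simp add: D_def algebra_simps)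
  moreover have "0 \<le> (d - e) * (H d - H b)"
    using H_le[OF that(2,1)] that by simp
  ultimately show ?thesis using D_pos[OF that(2,3)] that by linarith
qed

text \<open>Each point of \<open>T\<close> is compared with the endpoint on its own side of
  \<open>d\<close>. Conversely \<open>a\<close> and \<open>b\<close> need not belong to
  \<open>T\<close>, only to its closure, so the lower bound uses continuity of \<open>D\<close> in
  its first argument.\<close>

lemma SUP_D:
  assumes T: "T \<subseteq> \<Theta>" and a: "a \<in> \<Theta>" "(INF \<theta>\<in>T. ereal \<theta>) = ereal a"
    and b: "b \<in> \<Theta>" "(SUP \<theta>\<in>T. ereal \<theta>) = ereal b" and d: "d \<in> \<Theta>"
  shows "(SUP \<theta>\<in>T. ereal (D \<theta> d)) = ereal (max (D a d) (D b d))"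
proof (rule antisym)
  show "(SUP \<theta>\<in>T. ereal (D \<theta> d)) \<le> ereal (max (D a d) (D b d))"
  proof (rule SUP_least)
    fix \<theta> assume \<theta>: "\<theta> \<in> T"
    have "ereal a \<le> ereal \<theta>" using INF_lower[OF \<theta>, of ereal] a by simp
    moreover have "ereal \<theta> \<le> ereal b" using SUP_upper[OF \<theta>, of ereal] b by simp
    ultimately have "a \<le> \<theta>" "\<theta> \<le> b" by auto
    then show "ereal (D \<theta> d) \<le> ereal (max (D a d) (D b d))"
      using D_decreasing_left[of a \<theta> d] D_increasing_right[of b \<theta> d] a b d \<theta> T
      by (cases "\<theta> \<le> d") (auto simp: le_max_iff_disj)
  qed
  \<comment> \<open>Otherwise a real \<open>M\<close> fits strictly between the supremum and
    \<open>D c d\<close>, and continuity makes \<open>D\<close> exceed \<open>M\<close> at a point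
    of \<open>T\<close> near \<open>c\<close>.\<close>
  have limit: "ereal (D c d) \<le> (SUP \<theta>\<in>T. ereal (D \<theta> d))" if c: "c \<in> \<Theta>" "c \<in> closure T" for c
  proof (rule ccontr)
    assume "\<not> ?thesis"
    then have less: "(SUP \<theta>\<in>T. ereal (D \<theta> d)) < ereal (D c d)" by simp
    then obtain M where M: "(SUP \<theta>\<in>T. ereal (D \<theta> d)) < ereal M" "M < D c d"
      using ereal_dense2[OF less] by auto
    obtain e where e: "e > 0" "\<And>\<theta>. \<theta> \<in> \<Theta> \<Longrightarrow> dist \<theta> c < e \<Longrightarrow> dist (D \<theta> d) (D c d) < D c d - M"
      using D_continuous[of d] c(1) M(2) unfolding continuous_on_iff by (metis diff_gt_0_iff_gt)
    obtain \<theta> where \<theta>: "\<theta> \<in> T" "dist \<theta> c < e"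
      using c(2) e(1) by (auto simp: closure_approachable)
    have "M < D \<theta> d" using e(2)[of \<theta>] \<theta> T by (auto simp: dist_real_def)
    moreover have "ereal (D \<theta> d) < ereal M"
      using SUP_upper[OF \<theta>(1), of "\<lambda>\<theta>. ereal (D \<theta> d)"] M(1) by (rule order.strict_trans1)
    ultimately show False by simp
  qed
  have "a \<in> closure T"
    unfolding closure_approachable
  proof safe
    fix e :: real assume "e > 0"
    then have "(INF \<theta>\<in>T. ereal \<theta>) < ereal (a + e)" using a by simp
    then obtain \<theta> where \<theta>: "\<theta> \<in> T" "\<theta> < a + e" by (auto simp: INF_less_iff)
    moreover have "ereal a \<le> ereal \<theta>" using INF_lower[OF \<theta>(1), of ereal] a by simp
    ultimately show "\<exists>\<theta>\<in>T. dist \<theta> a < e"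
      by (intro bexI[of _ \<theta>]) (auto simp: dist_real_def)
  qed
  moreover have "b \<in> closure T"
    unfolding closure_approachable
  proof safe
    fix e :: real assume "e > 0"
    then have "ereal (b - e) < (SUP \<theta>\<in>T. ereal \<theta>)" using b by simp
    then obtain \<theta> where \<theta>: "\<theta> \<in> T" "b - e < \<theta>" by (auto simp: less_SUP_iff)
    moreover have "ereal \<theta> \<le> ereal b" using SUP_upper[OF \<theta>(1), of ereal] b by simp
    ultimately show "\<exists>\<theta>\<in>T. dist \<theta> b < e"
      by (intro bexI[of _ \<theta>]) (auto simp: dist_real_def)
  qed
  ultimately show "ereal (max (D a d) (D b d)) \<le> (SUP \<theta>\<in>T. ereal (D \<theta> d))"
    using limit[OF a(1)] limit[OF b(1)] by (simp add: max_def)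
qed

section \<open>The point where both extreme divergences agree\<close>

text \<open>For \<open>a < b\<close> this is the solution \<open>p\<close> of
  \<open>D a p = D b p\<close>, which is linear in \<open>p\<close> because \<open>g p\<close>
  cancels. For \<open>a = b\<close> that equation is void, and the value \<open>a\<close> makes the
  divergence zero.\<close>

definition balance :: "real \<Rightarrow> real \<Rightarrow> real" where
  "balance a b = (if a = b then a else (b * H b - a * H a - (g b - g a)) / (H b - H a))"

text \<open>The distances of the balance point from \<open>a\<close> and from \<open>b\<close>,
  multiplied by \<open>H a - H b\<close>, are \<open>D b a\<close> and \<open>D a b\<close>;
  nonnegativity of these places it between the two.\<close>

lemma balance:
  assumes ab: "a \<in> \<Theta>" "b \<in> \<Theta>" "a \<le> b"
  shows balance_ge: "a \<le> balance a b" and balance_le: "balance a b \<le> b"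
    and D_balance: "D a (balance a b) = D b (balance a b)"
proof -
  let ?p = "balance a b"
  consider "a = b" | "a < b" using ab by linarith
  then have "a \<le> ?p \<and> ?p \<le> b \<and> D a ?p = D b ?p"
  proof cases
    case 1
    then show ?thesis by (simp add: balance_def)
  next
    case 2
    then have H: "0 < H a - H b" using H_less ab by simp
    have p: "?p * (H a - H b) = a * H a - b * H b + (g b - g a)"
      using 2 H by (simp add: balance_def field_simps)
    have "(?p - a) * (H a - H b) = D b a"
      using p by (simp add: D_def algebra_simps)
    then have "0 \<le> (?p - a) * (H a - H b)" using D_nonneg ab by simp
    then have "a \<le> ?p" using H by (simp add: zero_le_mult_iff)
    moreover have "(b - ?p) * (H a - H b) = D a b"
      using p by (simp add: D_def algebra_simps)
    then have "0 \<le> (b - ?p) * (H a - H b)" using D_nonneg ab by simp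
    then have "?p \<le> b" using H by (simp add: zero_le_mult_iff)
    moreover have "D a ?p = D b ?p"
      using p by (simp add: D_def algebra_simps)
    ultimately show ?thesis by simp
  qed
  then show "a \<le> ?p" "?p \<le> b" "D a ?p = D b ?p" by auto
qed

lemma balance_in: "balance a b \<in> \<Theta>" if "a \<in> \<Theta>" "b \<in> \<Theta>" "a \<le> b"
  using mem_is_interval_1_I[OF interval that(1,2) balance_ge[OF that] balance_le[OF that]] .

text \<open>Moving right from the balance point raises \<open>D a\<close>, moving left raises
  \<open>D b\<close>; both agree at the start, so the maximum strictly rises either way.\<close>

lemma balance_minimax:
  assumes ab: "a \<in> \<Theta>" "b \<in> \<Theta>" "a \<le> b" and d: "d \<in> \<Theta>" "d \<noteq> balance a b"
  shows "max (D a (balance a b)) (D b (balance a b)) < max (D a d) (D b d)"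
proof (cases "balance a b < d")
  case True
  then show ?thesis
    using D_second_mono_right[OF ab(1) balance_in[OF ab] d(1) balance_ge[OF ab]] D_balance[OF ab]
    by (simp add: less_max_iff_disj)
next
  case False
  then show ?thesis
    using D_second_mono_left[OF ab(2) balance_in[OF ab] d(1) balance_le[OF ab]] D_balance[OF ab] d(2)
    by (simp add: less_max_iff_disj)
qed

end

section \<open>The log-normaliser of the exponential family\<close>

lemma space_reference_measure: "reference_measure S \<mu> \<Longrightarrow> space \<mu> = S"
  by (auto simp: reference_measure_def space_restrict_space)

lemma family_density_pos:
  "exponential_family S \<mu> \<Theta> \<beta> t r \<Longrightarrow> x \<in> S \<Longrightarrow> \<theta> \<in> \<Theta> \<Longrightarrow> 0 < family_density \<beta> t r x \<theta>"
  by (auto simp: exponential_family_def family_density_def)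

lemma family_density_integral:
  assumes fam: "exponential_family S \<mu> \<Theta> \<beta> t r" and \<theta>: "\<theta> \<in> \<Theta>"
  shows "integrable \<mu> (\<lambda>x. family_density \<beta> t r x \<theta>)"
    and "(\<integral>x. family_density \<beta> t r x \<theta> \<partial>\<mu>) = 1"
proof -
  have sp: "space \<mu> = S"
    using fam by (auto simp: exponential_family_def space_reference_measure)
  have [measurable]: "t \<in> borel_measurable \<mu>" "r \<in> borel_measurable \<mu>"
    using fam by (auto simp: exponential_family_def)
  have "(\<lambda>x. family_density \<beta> t r x \<theta>) \<in> borel_measurable \<mu>"
    unfolding family_density_def by measurable
  moreover have "AE x in \<mu>. 0 \<le> family_density \<beta> t r x \<theta>"
    using family_density_pos[OF fam _ \<theta>] sp by (intro AE_I2) (auto intro: less_imp_le)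
  moreover have "(\<integral>\<^sup>+x. ennreal (family_density \<beta> t r x \<theta>) \<partial>\<mu>) = ennreal 1"
    using fam \<theta> by (simp add: exponential_family_def)
  ultimately have "has_bochner_integral \<mu> (\<lambda>x. family_density \<beta> t r x \<theta>) 1"
    by (intro has_bochner_integral_nn_integral) auto
  then show "integrable \<mu> (\<lambda>x. family_density \<beta> t r x \<theta>)"
    "(\<integral>x. family_density \<beta> t r x \<theta> \<partial>\<mu>) = 1"
    by (auto simp: has_bochner_integral_iff)
qed

text \<open>Total mass 1 is impossible on an empty sample space. A sample point is wanted because
  positivity is assumed only for the products \<open>\<beta> \<theta> * t x\<close>.\<close>

lemma exponential_family_nonempty:
  assumes "exponential_family S \<mu> \<Theta> \<beta> t r" "\<Theta> \<noteq> {}"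
  obtains x where "x \<in> S"
proof -
  obtain \<theta> where "\<theta> \<in> \<Theta>" using assms by auto
  have "space \<mu> = S"
    using assms by (auto simp: exponential_family_def space_reference_measure)
  then have "S \<noteq> {}"
    using family_density_integral(2)[OF assms(1) \<open>\<theta> \<in> \<Theta>\<close>]
      Bochner_Integration.integral_cong[of \<mu> \<mu> "\<lambda>x. family_density \<beta> t r x \<theta>" "\<lambda>_. 0"] by auto
  then show ?thesis using that by auto
qed

text \<open>All values of \<open>\<beta>\<close> on \<open>\<Theta>\<close> share the sign of
  \<open>t x\<close> at one sample point. That sign may be negative, hence the absolute value in the
  potential \<open>ln |\<beta>|\<close>.\<close>

lemma normaliser_same_sign:
  assumes fam: "exponential_family S \<mu> \<Theta> \<beta> t r" and "\<theta> \<in> \<Theta>" "d \<in> \<Theta>"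
  shows "0 < \<beta> \<theta> / \<beta> d"
proof -
  obtain x where "x \<in> S" using exponential_family_nonempty[OF fam] assms(2) by blast
  then have "0 < \<beta> \<theta> * t x" "0 < \<beta> d * t x"
    using assms by (auto simp: exponential_family_def)
  then show ?thesis by (auto simp: zero_less_mult_iff zero_less_divide_iff)
qed

lemma ln_normaliser_ratio:
  assumes "exponential_family S \<mu> \<Theta> \<beta> t r" and "\<theta> \<in> \<Theta>" "d \<in> \<Theta>"
  shows "ln (\<beta> \<theta> / \<beta> d) = ln \<bar>\<beta> \<theta>\<bar> - ln \<bar>\<beta> d\<bar>"
proof -
  have *: "0 < \<beta> \<theta> / \<beta> d" using normaliser_same_sign[OF assms] .
  then have "ln (\<beta> \<theta> / \<beta> d) = ln (\<bar>\<beta> \<theta>\<bar> / \<bar>\<beta> d\<bar>)"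
    by (simp flip: abs_divide)
  also have "\<dots> = ln \<bar>\<beta> \<theta>\<bar> - ln \<bar>\<beta> d\<bar>"
    using * by (intro ln_divide_pos) auto
  finally show ?thesis .
qed

text \<open>Differentiating the logarithm of the ratio \<open>\<beta> d / \<beta> \<theta>\<close>,
  which equals 1 at \<open>d = \<theta>\<close>, avoids the absolute value; the two functions differ
  by a constant on \<open>\<Theta>\<close>.\<close>

lemma ln_normaliser_deriv:
  assumes fam: "exponential_family S \<mu> \<Theta> \<beta> t r" and \<theta>: "\<theta> \<in> \<Theta>"
  shows "((\<lambda>d. ln \<bar>\<beta> d\<bar>) has_real_derivative H_fun \<Theta> \<beta> \<theta>) (at \<theta> within \<Theta>)"
proof -
  have nz: "\<beta> \<theta> \<noteq> 0" using normaliser_same_sign[OF fam \<theta> \<theta>] by auto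
  have "\<beta> differentiable (at \<theta> within \<Theta>)"
    using fam \<theta> by (auto simp: exponential_family_def differentiable_on_def)
  then have "(\<beta> has_real_derivative vector_derivative \<beta> (at \<theta> within \<Theta>)) (at \<theta> within \<Theta>)"
    by (simp add: vector_derivative_works has_real_derivative_iff_has_vector_derivative)
  then have "((\<lambda>d. ln (\<beta> d / \<beta> \<theta>) + ln \<bar>\<beta> \<theta>\<bar>) has_real_derivative H_fun \<Theta> \<beta> \<theta>) (at \<theta> within \<Theta>)"
    using nz by (auto intro!: derivative_eq_intros simp: H_fun_def)
  then show ?thesis
    by (rule has_field_derivative_transform_within[where d = 1])
      (use ln_normaliser_ratio[OF fam _ \<theta>] \<theta> in auto)
qed

(* Convexity of exp bounds the geometric mean of two densities, which is a multiple of the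
   density at the intermediate parameter, by their arithmetic mean; then integrate. *)
lemma ln_normaliser_concave:
  assumes fam: "exponential_family S \<mu> \<Theta> \<beta> t r" and \<theta>: "\<theta> \<in> \<Theta>" and d: "d \<in> \<Theta>"
    and s: "0 < s" "s < 1"
  shows "(1 - s) * ln \<bar>\<beta> \<theta>\<bar> + s * ln \<bar>\<beta> d\<bar> \<le> ln \<bar>\<beta> ((1 - s) * \<theta> + s * d)\<bar>"
proof -
  define m where "m = (1 - s) * \<theta> + s * d"
  \<comment> \<open>\<open>C\<close> is the amount by which concavity would fail; the goal becomes
    \<open>exp C \<le> 1\<close>.\<close>
  define C where "C = (1 - s) * ln \<bar>\<beta> \<theta>\<bar> + s * ln \<bar>\<beta> d\<bar> - ln \<bar>\<beta> m\<bar>"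
  have "convex \<Theta>" using fam by (auto simp: exponential_family_def is_interval_convex)
  then have m: "m \<in> \<Theta>" using \<theta> d s by (auto simp: m_def convex_alt)
  have sp: "space \<mu> = S"
    using fam by (auto simp: exponential_family_def space_reference_measure)
  have exp_form: "family_density \<beta> t r x \<eta> = exp (ln \<bar>\<beta> \<eta>\<bar> + ln \<bar>t x\<bar> - \<eta> * r x)"
    if "x \<in> S" "\<eta> \<in> \<Theta>" for x \<eta>
  proof -
    have "0 < \<beta> \<eta> * t x" using fam that by (auto simp: exponential_family_def)
    then have "\<beta> \<eta> * t x = exp (ln \<bar>\<beta> \<eta>\<bar> + ln \<bar>t x\<bar>)"
      by (auto simp: exp_add zero_less_mult_iff)
    then show ?thesis
      by (simp add: family_density_def exp_diff exp_minus divide_inverse)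
  qed
  have "exp C * family_density \<beta> t r x m
      \<le> (1 - s) * family_density \<beta> t r x \<theta> + s * family_density \<beta> t r x d" if x: "x \<in> S" for x
  proof -
    let ?u = "ln \<bar>\<beta> \<theta>\<bar> + ln \<bar>t x\<bar> - \<theta> * r x" and ?v = "ln \<bar>\<beta> d\<bar> + ln \<bar>t x\<bar> - d * r x"
    \<comment> \<open>The exponent is affine in the parameter apart from
      \<open>ln |\<beta>|\<close>, and \<open>C\<close> corrects exactly that term.\<close>
    have "exp C * family_density \<beta> t r x m = exp ((1 - s) * ?u + s * ?v)"
      unfolding exp_form[OF x m] exp_add[symmetric]
      by (simp add: C_def m_def algebra_simps)
    also have "\<dots> \<le> (1 - s) * exp ?u + s * exp ?v"
      using convex_onD[OF exp_convex, of s ?u ?v] s by simp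
    finally show ?thesis using exp_form x \<theta> d by simp
  qed
  then have "(\<integral>x. exp C * family_density \<beta> t r x m \<partial>\<mu>)
      \<le> (\<integral>x. (1 - s) * family_density \<beta> t r x \<theta> + s * family_density \<beta> t r x d \<partial>\<mu>)"
    using family_density_integral(1)[OF fam] m \<theta> d sp by (intro integral_mono) auto
  also have "\<dots> = 1"
    using family_density_integral[OF fam \<theta>] family_density_integral[OF fam d] by simp
  finally have "exp C \<le> 1"
    using family_density_integral[OF fam m] by simp
  then show ?thesis by (simp add: C_def m_def)
qed

lemma concave_potential_ln_normaliser:
  assumes fam: "exponential_family S \<mu> \<Theta> \<beta> t r" and "inj_on (H_fun \<Theta> \<beta>) \<Theta>"
  shows "concave_potential \<Theta> (\<lambda>\<theta>. ln \<bar>\<beta> \<theta>\<bar>) (H_fun \<Theta> \<beta>)"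
proof
  show int: "is_interval \<Theta>" using fam by (simp add: exponential_family_def)
  fix x y assume "x \<in> \<Theta>" "y \<in> \<Theta>"
  then show "ln \<bar>\<beta> y\<bar> \<le> ln \<bar>\<beta> x\<bar> + H_fun \<Theta> \<beta> x * (y - x)"
    using concave_below_tangent_within[OF ln_normaliser_deriv[OF fam]]
      ln_normaliser_concave[OF fam] is_interval_convex[OF int] by blast
qed (use assms ln_normaliser_deriv in auto)

section \<open>Posterior regret\<close>

text \<open>Normalisation succeeds because the marginal is neither infinite, by \<open>fin\<close>,
  nor zero, the density being positive at every parameter.\<close>

lemma posterior_prob_space:
  assumes fam: "exponential_family S \<mu> \<Theta> \<beta> t r" and prior: "prior_on \<Theta> \<pi>"
    and x: "x \<in> S" and fin: "marginal \<beta> t r \<pi> x < \<infinity>"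
  shows "prob_space (posterior \<beta> t r \<pi> x)" and "space (posterior \<beta> t r \<pi> x) = \<Theta>"
proof -
  interpret prob_space \<pi> using prior by (simp add: prior_on_def)
  have sets: "sets \<pi> = sets (restrict_space borel \<Theta>)" using prior by (simp add: prior_on_def)
  have space: "space \<pi> = \<Theta>"
    using sets_eq_imp_space_eq[OF sets] by (simp add: space_restrict_space)
  have "\<beta> \<in> borel_measurable (restrict_space borel \<Theta>)"
    using fam by (intro borel_measurable_continuous_on_restrict differentiable_imp_continuous_on)
      (auto simp: exponential_family_def)
  then have [measurable]: "\<beta> \<in> borel_measurable \<pi>"
    using measurable_cong_sets[OF sets refl] by blast
  have "(\<lambda>\<theta>. \<theta>) \<in> borel_measurable (restrict_space borel \<Theta>)"
    by (rule measurable_restrict_space1) simp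
  then have [measurable]: "(\<lambda>\<theta>. \<theta>) \<in> borel_measurable \<pi>"
    using measurable_cong_sets[OF sets refl] by blast
  have [measurable]: "family_density \<beta> t r x \<in> borel_measurable \<pi>"
    unfolding family_density_def by measurable
  have "marginal \<beta> t r \<pi> x \<noteq> 0"
  proof
    assume "marginal \<beta> t r \<pi> x = 0"
    then have "AE \<theta> in \<pi>. ennreal (family_density \<beta> t r x \<theta>) = 0"
      by (simp add: marginal_def nn_integral_0_iff_AE)
    moreover have "AE \<theta> in \<pi>. 0 < family_density \<beta> t r x \<theta>"
      using family_density_pos[OF fam x] space by (intro AE_I2) auto
    ultimately have "AE \<theta> in \<pi>. False" by eventually_elim auto
    then show False by simp
  qed
  then have "(\<integral>\<^sup>+\<theta>. ennreal (family_density \<beta> t r x \<theta>) / marginal \<beta> t r \<pi> x \<partial>\<pi>) = 1"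
    using fin by (simp add: nn_integral_divide flip: marginal_def)
  then show "prob_space (posterior \<beta> t r \<pi> x)"
    by (intro prob_spaceI) (simp add: posterior_def emeasure_density cong: nn_integral_cong)
  show "space (posterior \<beta> t r \<pi> x) = \<Theta>"
    using space by (simp add: posterior_def)
qed

text \<open>In the difference of two losses the parameter survives only through
  \<open>H \<theta>\<close>. With \<open>H c\<close> equal to the posterior mean of
  \<open>H\<close>, the excess risk of \<open>d\<close> over \<open>c\<close> is therefore
  \<open>D c d\<close>, and \<open>c\<close> is the unique minimiser.\<close>

lemma bayes_estimator_regret:
  fixes \<Theta> \<beta>
  defines "g \<equiv> \<lambda>\<theta>. ln \<bar>\<beta> \<theta>\<bar>" and "H \<equiv> H_fun \<Theta> \<beta>"
  assumes fam: "exponential_family S \<mu> \<Theta> \<beta> t r" and inj: "inj_on H \<Theta>"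
    and prior: "prior_on \<Theta> \<pi>" and x: "x \<in> S"
    and fin: "finite_posterior_risk \<Theta> \<beta> t r \<pi> x"
  shows "bayes_estimator \<Theta> \<beta> t r \<pi> x \<in> \<Theta>"
    and "d \<in> \<Theta> \<Longrightarrow> posterior_regret \<Theta> \<beta> t r \<pi> x d
           = concave_potential.D g H (bayes_estimator \<Theta> \<beta> t r \<pi> x) d"
proof -
  interpret cp: concave_potential \<Theta> g H
    using concave_potential_ln_normaliser fam inj unfolding g_def H_def by blast
  let ?Q = "posterior \<beta> t r \<pi> x" and ?R = "posterior_risk \<Theta> \<beta> t r \<pi> x"
  have marg: "marginal \<beta> t r \<pi> x < \<infinity>" using fin by (simp add: finite_posterior_risk_def)
  interpret Q: prob_space ?Q by (rule posterior_prob_space[OF fam prior x marg])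
  have space: "space ?Q = \<Theta>" by (rule posterior_prob_space[OF fam prior x marg])
  have L_int: "integrable ?Q (\<lambda>\<theta>. intrinsic_loss \<Theta> \<beta> \<theta> d)" if "d \<in> \<Theta>" for d
    using fin that by (simp add: finite_posterior_risk_def)
  have L_diff: "intrinsic_loss \<Theta> \<beta> \<theta> d - intrinsic_loss \<Theta> \<beta> \<theta> e = g e - g d + (d - e) * H \<theta>"
    if "\<theta> \<in> \<Theta>" "d \<in> \<Theta>" "e \<in> \<Theta>" for \<theta> d e
    using ln_normaliser_ratio[OF fam] that
    by (simp add: intrinsic_loss_def g_def H_def algebra_simps)
  \<comment> \<open>Two distinct estimates express \<open>H\<close> through the difference of their
    integrable losses; if \<open>\<Theta>\<close> is a single point, \<open>H\<close> is constant on
    it.\<close>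
  have H_int: "integrable ?Q H"
  proof (cases "\<exists>d\<in>\<Theta>. \<exists>e\<in>\<Theta>. d \<noteq> e")
    case True
    then obtain d e where de: "d \<in> \<Theta>" "e \<in> \<Theta>" "d \<noteq> e" by blast
    let ?f = "\<lambda>\<theta>. (intrinsic_loss \<Theta> \<beta> \<theta> d - intrinsic_loss \<Theta> \<beta> \<theta> e - (g e - g d)) / (d - e)"
    have "integrable ?Q ?f" using L_int de by auto
    moreover have "integrable ?Q ?f \<longleftrightarrow> integrable ?Q H"
      using de L_diff space by (intro Bochner_Integration.integrable_cong) auto
    ultimately show ?thesis by simp
  next
    case False
    obtain c where "c \<in> \<Theta>" using Q.not_empty space by auto
    with False have "integrable ?Q H \<longleftrightarrow> integrable ?Q (\<lambda>_. H c)"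
      using space by (intro Bochner_Integration.integrable_cong) auto
    then show ?thesis by simp
  qed
  obtain c where c: "c \<in> \<Theta>" "H c = (\<integral>\<theta>. H \<theta> \<partial>?Q)"
    using cp.H_attains_mean[OF Q.prob_space_axioms space H_int] by blast
  have R: "?R d - ?R c = cp.D c d" if d: "d \<in> \<Theta>" for d
  proof -
    have "?R d - ?R c = (\<integral>\<theta>. intrinsic_loss \<Theta> \<beta> \<theta> d - intrinsic_loss \<Theta> \<beta> \<theta> c \<partial>?Q)"
      using L_int d c by (simp add: posterior_risk_def)
    also have "\<dots> = (\<integral>\<theta>. g c - g d + (d - c) * H \<theta> \<partial>?Q)"
      using L_diff d c space by (intro Bochner_Integration.integral_cong) auto
    also have "\<dots> = cp.D c d"
      using H_int c by (simp add: cp.D_def Q.prob_space)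
    finally show ?thesis .
  qed
  have less: "?R c < ?R d" if "d \<in> \<Theta>" "d \<noteq> c" for d
    using R[OF that(1)] cp.D_pos[OF c(1) that(1)] that(2) by simp
  \<comment> \<open>\<open>arg_min_on\<close> chooses some minimiser; strict inequality at every
    other point forces the choice.\<close>
  have bayes: "bayes_estimator \<Theta> \<beta> t r \<pi> x = c"
    unfolding bayes_estimator_def arg_min_on_def arg_min_def is_arg_min_def
  proof (rule some_equality)
    show "c \<in> \<Theta> \<and> (\<nexists>y. y \<in> \<Theta> \<and> ?R y < ?R c)"
      using c(1) less by (metis order.asym)
    fix y assume "y \<in> \<Theta> \<and> (\<nexists>z. z \<in> \<Theta> \<and> ?R z < ?R y)"
    then show "y = c" using c(1) less by blast
  qed
  show "bayes_estimator \<Theta> \<beta> t r \<pi> x \<in> \<Theta>" using bayes c by simp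
  show "posterior_regret \<Theta> \<beta> t r \<pi> x d = cp.D (bayes_estimator \<Theta> \<beta> t r \<pi> x) d" if "d \<in> \<Theta>"
    using R[OF that] by (simp add: posterior_regret_def bayes)
qed

section \<open>The minimax problem at a fixed observation\<close>

text \<open>Constant functions show that evaluation at \<open>x\<close> maps
  \<open>S \<rightarrow> B\<close> onto \<open>B\<close>, so optimising over estimators is
  optimising over single estimates.\<close>

lemma INF_funcset_eval:
  assumes "x \<in> S"
  shows "(INF f\<in>S \<rightarrow> B. h (f x)) = (INF d\<in>B. h d)"
proof -
  have "(\<lambda>f. f x) ` (S \<rightarrow> B) = B"
  proof (intro set_eqI iffI)
    fix d assume "d \<in> B"
    then show "d \<in> (\<lambda>f. f x) ` (S \<rightarrow> B)" by (intro image_eqI[of _ _ "\<lambda>_. d"]) auto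
  qed (use assms in auto)
  then show ?thesis by (metis image_image)
qed

text \<open>Replacing each prior by its Bayes estimate turns the maximal regret into a supremum of
  \<open>D\<close> over the set \<open>?T\<close>. The equivalence delivers existence and uniqueness
  at once.\<close>

lemma PRGM_pointwise:
  assumes fam: "exponential_family S \<mu> \<Theta> \<beta> t r"
    and inj: "inj_on (H_fun \<Theta> \<beta>) \<Theta>"
    and priors: "\<And>\<pi>. \<pi> \<in> \<Gamma> \<Longrightarrow> prior_on \<Theta> \<pi>"
    and x: "x \<in> S" and fin: "\<forall>\<pi>\<in>\<Gamma>. finite_posterior_risk \<Theta> \<beta> t r \<pi> x"
    and a: "lower_bayes \<Theta> \<beta> t r \<Gamma> x = ereal a" "a \<in> \<Theta>"
    and b: "upper_bayes \<Theta> \<beta> t r \<Gamma> x = ereal b" "b \<in> \<Theta>"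
  shows "d \<in> \<Theta> \<and> max_regret \<Theta> \<beta> t r \<Gamma> x d = (INF \<delta>'\<in>S \<rightarrow> \<Theta>. max_regret \<Theta> \<beta> t r \<Gamma> x (\<delta>' x))
    \<longleftrightarrow> d = PRGM_value \<Theta> \<beta> a b"
proof -
  let ?g = "\<lambda>\<theta>. ln \<bar>\<beta> \<theta>\<bar>" and ?H = "H_fun \<Theta> \<beta>"
  interpret cp: concave_potential \<Theta> ?g ?H
    by (rule concave_potential_ln_normaliser[OF fam inj])
  let ?T = "(\<lambda>\<pi>. bayes_estimator \<Theta> \<beta> t r \<pi> x) ` \<Gamma>"
  have T: "?T \<subseteq> \<Theta>"
    using bayes_estimator_regret(1)[OF fam inj priors x] fin by blast
  have INF: "(INF \<theta>\<in>?T. ereal \<theta>) = ereal a" and SUP: "(SUP \<theta>\<in>?T. ereal \<theta>) = ereal b"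
    using a b by (simp_all add: lower_bayes_def upper_bayes_def image_image)
  \<comment> \<open>Over an empty class the infimum would be infinite rather than the real number
    \<open>a\<close>.\<close>
  have "\<Gamma> \<noteq> {}" using a by (auto simp: lower_bayes_def top_ereal_def)
  then obtain \<theta> where "\<theta> \<in> ?T" by auto
  then have "ereal a \<le> ereal b"
    using INF_lower[of \<theta> ?T ereal] SUP_upper[of \<theta> ?T ereal] INF SUP by (metis order.trans)
  then have ab: "a \<le> b" by simp
  have V: "max_regret \<Theta> \<beta> t r \<Gamma> x d = ereal (max (cp.D a d) (cp.D b d))" if d: "d \<in> \<Theta>" for d
  proof -
    have "max_regret \<Theta> \<beta> t r \<Gamma> x d = (SUP \<theta>\<in>?T. ereal (cp.D \<theta> d))"
      unfolding max_regret_def image_image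
      by (intro SUP_cong) (use bayes_estimator_regret(2)[OF fam inj priors x] fin d in auto)
    then show ?thesis using cp.SUP_D[OF T a(2) INF b(2) SUP d] by simp
  qed
  let ?p = "cp.balance a b"
  have p: "?p \<in> \<Theta>" using cp.balance_in a b ab by simp
  have less: "max_regret \<Theta> \<beta> t r \<Gamma> x ?p < max_regret \<Theta> \<beta> t r \<Gamma> x d" if "d \<in> \<Theta>" "d \<noteq> ?p" for d
    unfolding V[OF p] V[OF that(1)] less_ereal.simps
    by (rule cp.balance_minimax[OF a(2) b(2) ab that])
  have "(INF \<delta>'\<in>S \<rightarrow> \<Theta>. max_regret \<Theta> \<beta> t r \<Gamma> x (\<delta>' x)) = max_regret \<Theta> \<beta> t r \<Gamma> x ?p"
    unfolding INF_funcset_eval[OF x, of "max_regret \<Theta> \<beta> t r \<Gamma> x"]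
  proof (rule antisym[OF INF_lower[OF p] INF_greatest])
    show "max_regret \<Theta> \<beta> t r \<Gamma> x ?p \<le> max_regret \<Theta> \<beta> t r \<Gamma> x d" if "d \<in> \<Theta>" for d
      using less[OF that] by (cases "d = ?p") auto
  qed
  moreover have "?p = PRGM_value \<Theta> \<beta> a b"
    using ln_normaliser_ratio[OF fam b(2) a(2)] by (simp add: cp.balance_def PRGM_value_def)
  ultimately show ?thesis using less p by (metis less_irrefl)
qed

theorem theorem1:
  fixes S \<Theta> :: "real set" and \<mu> :: "real measure"
    and \<beta> t r :: "real \<Rightarrow> real" and \<Gamma> :: "real measure set"
    and lo hi \<delta>_PR :: "real \<Rightarrow> real"
  assumes family: "exponential_family S \<mu> \<Theta> \<beta> t r"
    and H_inj: "inj_on (H_fun \<Theta> \<beta>) \<Theta>"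
    and priors: "\<And>\<pi>. \<pi> \<in> \<Gamma> \<Longrightarrow> prior_on \<Theta> \<pi>"
    and risk_finite: "AE x in \<mu>. \<forall>\<pi>\<in>\<Gamma>. finite_posterior_risk \<Theta> \<beta> t r \<pi> x"
    and bounds_finite: "AE x in \<mu>. lower_bayes \<Theta> \<beta> t r \<Gamma> x = ereal (lo x) \<and>
                                    upper_bayes \<Theta> \<beta> t r \<Gamma> x = ereal (hi x)"
    and bounds_in_\<Theta>: "AE x in \<mu>. lo x \<in> \<Theta> \<and> hi x \<in> \<Theta>"
    and \<delta>_PR: "\<And>x. \<delta>_PR x = PRGM_value \<Theta> \<beta> (lo x) (hi x)"
  shows "PRGM_estimator S \<mu> \<Theta> \<beta> t r \<Gamma> \<delta>_PR \<and>
         (\<forall>\<delta>. PRGM_estimator S \<mu> \<Theta> \<beta> t r \<Gamma> \<delta> \<longrightarrow> (AE x in \<mu>. \<delta> x = \<delta>_PR x))"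
proof -
  have "space \<mu> = S"
    using family by (auto simp: exponential_family_def space_reference_measure)
  then have "AE x in \<mu>. x \<in> S" by (intro AE_I2) simp
  \<comment> \<open>The quantifier over \<open>d\<close> stands inside, so a single null set serves
    all estimates, including a value \<open>\<delta> x\<close> that varies with
    \<open>x\<close>.\<close>
  then have *: "AE x in \<mu>. \<forall>d. (d \<in> \<Theta> \<and> max_regret \<Theta> \<beta> t r \<Gamma> x d
      = (INF \<delta>'\<in>S \<rightarrow> \<Theta>. max_regret \<Theta> \<beta> t r \<Gamma> x (\<delta>' x))) \<longleftrightarrow> d = \<delta>_PR x"
    using risk_finite bounds_finite bounds_in_\<Theta>
  proof eventually_elim
    case (elim x)
    then show ?case
      using PRGM_pointwise[OF family H_inj priors, where x = x and a = "lo x" and b = "hi x"] \<delta>_PR by simp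
  qed
  have "PRGM_estimator S \<mu> \<Theta> \<beta> t r \<Gamma> \<delta>_PR"
    unfolding PRGM_estimator_def using * by eventually_elim blast
  moreover have "AE x in \<mu>. \<delta> x = \<delta>_PR x" if "PRGM_estimator S \<mu> \<Theta> \<beta> t r \<Gamma> \<delta>" for \<delta>
    using that[unfolded PRGM_estimator_def] * by eventually_elim blast
  ultimately show ?thesis by blast
qed

end
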